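(* Every loopless cubic multigraph $G$ that admits a nowhere-zero three-bit flow has a cycle double cover. Moreover, fix a nowhere-zero three-bit flow $f$ on $G$, an ordering $a_v,b_v,c_v$ of the edges incident with each vertex $v$, and a solution $(t_v)_{v\in V(G)},(\epsilon_e)_{e\in E(G)}$ of the associated triangle-gluing system, and let $G_s$ ($s\in\mathbb F_2^3$) be the resulting label subgraphs. Then the occurrences in a cycle double cover of $G$ can be indexed by the pairs $(s,K)$, where $s\in\mathbb F_2^3$ and $K$ is an edge-containing connected component of $G_s$: the multiset in which each such pair $(s,K)$ contributes one occurrence of $K$ is a cycle double cover of $G$.
   Context: Graphs are finite undirected multigraphs; parallel edges are distinct edge objects. Cubic means every vertex has degree three. A cycle is a connected 2-regular subgraph (two parallel edges form a cycle of length two). A cycle double cover of $G$ is a finite multiset of cycles of $G$ such that every edge belongs to exactly two members, counted with multiplicity. $\delta(v)$ is the set of edges incident with $v$; $\oplus$ is addition in $\mathbb F_2^3=\{0,1\}^3$, with zero $000$; $\epsilon s$ is scalar multiplication of a vector $s$ by a bit $\epsilon$. A three-bit flow is a map $f\colon E(G)\to\mathbb F_2^3$ such that, for an orientation of the edges, at every vertex the sum of $f$ over outgoing edges equals the sum over incoming edges; for loopless $G$ this is equivalent, independently of the orientation, to $\bigoplus_{e\in\delta(v)}f(e)=000$ at every vertex $v$. It is nowhere-zero if $f(e)\neq 000$ for all $e$. Given $f$ and the orderings: for $e\in\delta(v)$ let $g_{v,e}=f(a_v)$ if $e=b_v$ and $g_{v,e}=000$ if $e\in\{a_v,c_v\}$;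 for $e=uv$ let $d_e=g_{u,e}\oplus g_{v,e}$. The triangle-gluing system is the family of equations $t_u\oplus t_v\oplus\epsilon_e f(e)=d_e$, one for each edge $e=uv$, with unknowns $t_v\in\mathbb F_2^3$ ($v\in V(G)$) and $\epsilon_e\in\{0,1\}$ ($e\in E(G)$). For a solution, the sets $\{t_w\oplus g_{w,e},\ t_w\oplus g_{w,e}\oplus f(e)\}$ for the two endpoints $w=u,v$ of an edge $e=uv$ coincide; their common value is a two-element set denoted $P_e$. For $s\in\mathbb F_2^3$, the label subgraph $G_s$ is the spanning subgraph of $G$ with edge set $M_s=\{e\in E(G): s\in P_e\}$. *)

theory Defs
  imports
    "HOL-Analysis.Finite_Cartesian_Product"
    "HOL-Library.Numeral_Type"
    "HOL-Library.Multiset"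
    "HOL-Library.Uprod"
    "HOL-Library.Z2"
begin

(* Undirected multigraphs: edges are objects of their own, and ends sends an edge to the
   unordered pair of its end vertices. The pair Upair v v encodes a loop at v. *)
record ('v, 'e) multigraph =
  verts :: "'v set"
  edges :: "'e set"
  ends :: "'e \<Rightarrow> 'v uprod"

definition finite_multigraph :: "('v, 'e) multigraph \<Rightarrow> bool" where
  "finite_multigraph G \<longleftrightarrow>
     finite (verts G) \<and> finite (edges G) \<and> (\<forall>e\<in>edges G. set_uprod (ends G e) \<subseteq> verts G)"

definition loopless :: "('v, 'e) multigraph \<Rightarrow> bool" where
  "loopless G \<longleftrightarrow> (\<forall>e\<in>edges G. proper_uprod (ends G e))"

definition incident :: "('v, 'e) multigraph \<Rightarrow> 'v \<Rightarrow> 'e set" where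
  "incident G v = {e \<in> edges G. v \<in> set_uprod (ends G e)}"

(* A loop counts twice. *)
definition degree :: "('v, 'e) multigraph \<Rightarrow> 'v \<Rightarrow> nat" where
  "degree G v = card (incident G v) + card {e \<in> edges G. ends G e = Upair v v}"

definition regular :: "nat \<Rightarrow> ('v, 'e) multigraph \<Rightarrow> bool" where
  "regular k G \<longleftrightarrow> (\<forall>v\<in>verts G. degree G v = k)"

abbreviation cubic :: "('v, 'e) multigraph \<Rightarrow> bool" where
  "cubic G \<equiv> regular 3 G"

(* Requiring equality of the whole incidence functions makes a subgraph of G
   determined by its vertex set and its edge set. *)
definition subgraph :: "('v, 'e) multigraph \<Rightarrow> ('v, 'e) multigraph \<Rightarrow> bool" where
  "subgraph H G \<longleftrightarrow> finite_multigraph H \<and> verts H \<subseteq> verts G \<and> edges H \<subseteq> edges G \<and> ends H = ends G"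

definition adjacency :: "('v, 'e) multigraph \<Rightarrow> ('v \<times> 'v) set" where
  "adjacency G = {(u, v). \<exists>e\<in>edges G. ends G e = Upair u v}"

definition connected_graph :: "('v, 'e) multigraph \<Rightarrow> bool" where
  "connected_graph G \<longleftrightarrow> verts G \<noteq> {} \<and> (\<forall>u\<in>verts G. \<forall>v\<in>verts G. (u, v) \<in> (adjacency G)\<^sup>*)"

definition components :: "('v, 'e) multigraph \<Rightarrow> ('v, 'e) multigraph set" where
  "components G = {K. subgraph K G \<and> connected_graph K \<and>
     (\<forall>H. subgraph H G \<and> connected_graph H \<and> subgraph K H \<longrightarrow> H = K)}"

definition cycle_of :: "('v, 'e) multigraph \<Rightarrow> ('v, 'e) multigraph \<Rightarrow> bool" where
  "cycle_of G C \<longleftrightarrow> subgraph C G \<and> connected_graph C \<and> regular 2 C"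

definition cycle_double_cover ::
    "('v, 'e) multigraph \<Rightarrow> ('v, 'e) multigraph multiset \<Rightarrow> bool" where
  "cycle_double_cover G M \<longleftrightarrow>
     (\<forall>C\<in>#M. cycle_of G C) \<and> (\<forall>e\<in>edges G. size {#C \<in># M. e \<in> edges C#} = 2)"

type_synonym bits3 = "bit ^ 3"

definition orientation ::
    "('v, 'e) multigraph \<Rightarrow> ('e \<Rightarrow> 'v) \<Rightarrow> ('e \<Rightarrow> 'v) \<Rightarrow> bool" where
  "orientation G tail head \<longleftrightarrow> (\<forall>e\<in>edges G. ends G e = Upair (tail e) (head e))"

definition three_bit_flow :: "('v, 'e) multigraph \<Rightarrow> ('e \<Rightarrow> bits3) \<Rightarrow> bool" where
  "three_bit_flow G f \<longleftrightarrow> (\<exists>tail head. orientation G tail head \<and>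
     (\<forall>v\<in>verts G. (\<Sum>e | e \<in> edges G \<and> tail e = v. f e) = (\<Sum>e | e \<in> edges G \<and> head e = v. f e)))"

definition nowhere_zero :: "('v, 'e) multigraph \<Rightarrow> ('e \<Rightarrow> bits3) \<Rightarrow> bool" where
  "nowhere_zero G f \<longleftrightarrow> (\<forall>e\<in>edges G. f e \<noteq> 0)"

definition incidence_ordering ::
    "('v, 'e) multigraph \<Rightarrow> ('v \<Rightarrow> 'e) \<Rightarrow> ('v \<Rightarrow> 'e) \<Rightarrow> ('v \<Rightarrow> 'e) \<Rightarrow> bool" where
  "incidence_ordering G a b c \<longleftrightarrow>
     (\<forall>v\<in>verts G. distinct [a v, b v, c v] \<and> incident G v = {a v, b v, c v})"

(* Only meaningful for e incident with v, where the remaining cases are e = a v and e = c v. *)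
definition corner ::
    "('e \<Rightarrow> bits3) \<Rightarrow> ('v \<Rightarrow> 'e) \<Rightarrow> ('v \<Rightarrow> 'e) \<Rightarrow> 'v \<Rightarrow> 'e \<Rightarrow> bits3" where
  "corner f a b v e = (if e = b v then f (a v) else 0)"

(* The right-hand side of the equation of e is the sum of the corner values of e at u and v. *)
definition gluing_solution ::
    "('v, 'e) multigraph \<Rightarrow> ('e \<Rightarrow> bits3) \<Rightarrow> ('v \<Rightarrow> 'e) \<Rightarrow> ('v \<Rightarrow> 'e) \<Rightarrow>
     ('v \<Rightarrow> bits3) \<Rightarrow> ('e \<Rightarrow> bit) \<Rightarrow> bool" where
  "gluing_solution G f a b t \<epsilon> \<longleftrightarrow>
     (\<forall>e\<in>edges G. \<forall>u v. ends G e = Upair u v \<longrightarrow>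
        t u + t v + \<epsilon> e *s f e = corner f a b u e + corner f a b v e)"

(* The common value of the sets at the two ends of e; it is unique when the gluing
   equation of e holds (lemma edge_labels_eq below). *)
definition edge_labels ::
    "('v, 'e) multigraph \<Rightarrow> ('e \<Rightarrow> bits3) \<Rightarrow> ('v \<Rightarrow> 'e) \<Rightarrow> ('v \<Rightarrow> 'e) \<Rightarrow>
     ('v \<Rightarrow> bits3) \<Rightarrow> 'e \<Rightarrow> bits3 set" where
  "edge_labels G f a b t e =
     (THE P. \<forall>w\<in>set_uprod (ends G e).
        P = {t w + corner f a b w e, t w + corner f a b w e + f e})"

definition label_subgraph ::
    "('v, 'e) multigraph \<Rightarrow> ('e \<Rightarrow> bits3) \<Rightarrow> ('v \<Rightarrow> 'e) \<Rightarrow> ('v \<Rightarrow> 'e) \<Rightarrow>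
     ('v \<Rightarrow> bits3) \<Rightarrow> bits3 \<Rightarrow> ('v, 'e) multigraph" where
  "label_subgraph G f a b t s =
     \<lparr>verts = verts G, edges = {e \<in> edges G. s \<in> edge_labels G f a b t e}, ends = ends G\<rparr>"

definition label_pairs ::
    "('v, 'e) multigraph \<Rightarrow> ('e \<Rightarrow> bits3) \<Rightarrow> ('v \<Rightarrow> 'e) \<Rightarrow> ('v \<Rightarrow> 'e) \<Rightarrow>
     ('v \<Rightarrow> bits3) \<Rightarrow> (bits3 \<times> ('v, 'e) multigraph) set" where
  "label_pairs G f a b t =
     {(s, K). K \<in> components (label_subgraph G f a b t s) \<and> edges K \<noteq> {}}"

(* mset_set of an infinite set is empty, but label_pairs is finite for every finite
   multigraph (lemma finite_label_pairs below). *)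
definition label_components ::
    "('v, 'e) multigraph \<Rightarrow> ('e \<Rightarrow> bits3) \<Rightarrow> ('v \<Rightarrow> 'e) \<Rightarrow> ('v \<Rightarrow> 'e) \<Rightarrow>
     ('v \<Rightarrow> bits3) \<Rightarrow> ('v, 'e) multigraph multiset" where
  "label_components G f a b t = image_mset snd (mset_set (label_pairs G f a b t))"

lemma bits3_add_self: "x + x = (0 :: bits3)"
  by (simp add: vec_eq_iff)

lemma edge_labels_eq:
  assumes sol: "gluing_solution G f a b t \<epsilon>" and e: "e \<in> edges G"
    and w: "w \<in> set_uprod (ends G e)"
  shows "edge_labels G f a b t e = {t w + corner f a b w e, t w + corner f a b w e + f e}"
proof -
  obtain u v where uv: "ends G e = Upair u v"
    by (cases "ends G e")
  let ?P = "\<lambda>w. {t w + corner f a b w e, t w + corner f a b w e + f e}"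
  have eq: "t u + t v + \<epsilon> e *s f e = corner f a b u e + corner f a b v e"
    using sol e uv by (simp add: gluing_solution_def)
  have cancel: "x + (x + y) = y" for x y :: bits3
    by (simp add: add.assoc [symmetric] bits3_add_self)
  have "t v + corner f a b v e =
      t u + (t u + t v + \<epsilon> e *s f e) + \<epsilon> e *s f e + corner f a b v e"
    by (simp add: ac_simps cancel bits3_add_self)
  also have "\<dots> = t u + corner f a b u e + \<epsilon> e *s f e"
    unfolding eq by (simp add: ac_simps cancel bits3_add_self)
  finally have v: "t v + corner f a b v e = t u + corner f a b u e + \<epsilon> e *s f e" .
  have scale: "(0 :: bit) *s x = 0" "(1 :: bit) *s x = x" for x :: bits3
    by (simp_all only: vec_eq_iff vector_smult_component zero_index mult_zero_left mult_1_left simp_thms)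
  have "?P u = ?P v"
  proof (cases "\<epsilon> e = 0")
    case True
    then show ?thesis
      unfolding v by (simp only: scale add_0_right)
  next
    case False
    then have "\<epsilon> e = 1"
      by simp
    then show ?thesis
      unfolding v
      by (simp only: scale add.assoc bits3_add_self add_0_right insert_commute)
  qed
  then have "\<forall>x\<in>set_uprod (ends G e). ?P w = ?P x"
    using w uv by auto
  then show ?thesis
    unfolding edge_labels_def
  proof (rule the_equality)
    fix P assume "\<forall>x\<in>set_uprod (ends G e). P = ?P x"
    then show "P = ?P w"
      by (rule bspec [OF _ w])
  qed
qed

lemma finite_label_pairs:
  assumes "finite_multigraph G"
  shows "finite (label_pairs G f a b t)"
proof -
  have bit: "finite (UNIV :: bit set)"
    by (rule finite_subset [of _ "{0, 1}"]) auto
  have "finite (PiE UNIV (\<lambda>_ :: 3. UNIV :: bit set))"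
    by (intro finite_PiE bit) simp
  then have "finite ((\<lambda>(x :: bits3) i. x $ i) -` PiE UNIV (\<lambda>_. UNIV))"
    by (rule finite_vimageI) (simp add: inj_def vec_eq_iff fun_eq_iff)
  then have "finite (UNIV :: bits3 set)"
    by simp
  moreover have "label_pairs G f a b t \<subseteq> UNIV \<times>
      (\<lambda>(V, E). \<lparr>verts = V, edges = E, ends = ends G\<rparr>) ` (Pow (verts G) \<times> Pow (edges G))"
    (is "_ \<subseteq> UNIV \<times> ?S")
  proof -
    have "K \<in> ?S" if "subgraph K (label_subgraph G f a b t s)" for s K
      using that
      by (intro image_eqI [where x = "(verts K, edges K)"])
        (auto simp: subgraph_def label_subgraph_def)
    then show ?thesis
      by (auto simp: label_pairs_def components_def)
  qed
  moreover have "finite ((UNIV :: bits3 set) \<times> ?S)" if "finite (UNIV :: bits3 set)"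
    using assms that by (simp add: finite_multigraph_def)
  ultimately show ?thesis
    by (blast intro: finite_subset)
qed

end

theory Submission
  imports Defs "HOL-Analysis.Cartesian_Space"
begin

text \<open>
  The components give a double cover because of the picture at a vertex: the label sets of the
  three edges at \<open>v\<close> are the sides of the triangle with corners \<open>t v\<close>, \<open>t v + f (a v)\<close> and
  \<open>t v + f (c v)\<close>. So a label occurs at \<open>v\<close> on no edge or on exactly two
  (\<open>label_subgraph_degree\<close>), and every component with an edge of a label subgraph is a cycle. An
  edge has two labels, and for each of them it lies in one component
  (\<open>size_label_components_containing\<close>).

  The existence of some double cover thereby reduces to solving the gluing system, which is linear
  over the field with two elements and is in fact always solvable. By the Fredholm alternative
  (\<open>linear_system_solvable\<close>), the right-hand side has to be orthogonal to the annihilators of the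
  system. These are the assignments \<open>y\<close> of a vector to each edge that sum to zero at each
  vertex and have \<open>y e\<close> orthogonal to \<open>f e\<close>. Pairing \<open>y\<close> with the right-hand side
  leaves one term \<open>y (b v) \<odot> f (a v)\<close> for each vertex \<open>v\<close>. In dimension three this term is the
  parity of the number of edges at \<open>v\<close> on which \<open>y\<close> is nonzero (\<open>orthogonal_triples_parity\<close>):
  the values of \<open>f\<close> at \<open>v\<close> span a plane, and a plane has only one nonzero normal vector.
  Every edge has two ends, so the sum of these parities over all vertices is even, as in the
  handshake lemma (\<open>annihilator_orthogonal\<close>).
\<close>

section \<open>The Fredholm alternative for finite linear systems\<close>

text \<open>
  Induction on the set of unknowns: if some equation \<open>p\<close> has a nonzero coefficient at the new
  unknown, Gaussian elimination with pivot \<open>p\<close> removes that unknown together with the equation.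
\<close>

lemma linear_system_solvable:
  fixes A :: "'i \<Rightarrow> 'x \<Rightarrow> 'k::field"
  assumes "finite X" "finite I"
    and "\<And>y. (\<forall>x\<in>X. (\<Sum>i\<in>I. y i * A i x) = 0) \<Longrightarrow> (\<Sum>i\<in>I. y i * d i) = 0"
  shows "\<exists>z. \<forall>i\<in>I. (\<Sum>x\<in>X. A i x * z x) = d i"
  using assms
proof (induction X arbitrary: I A d rule: finite_induct)
  case empty
  have "d i = 0" if i: "i \<in> I" for i
    using empty(2)[of "\<lambda>j. if j = i then 1 else 0"] i empty(1)
    by (simp add: if_distrib[of "\<lambda>c. c * _"] cong: if_cong)
  then show ?case by simp
next
  case (insert x X)
  show ?case
  proof (cases "\<exists>p\<in>I. A p x \<noteq> 0")
    case False
    then have col: "A i x = 0" if "i \<in> I" for i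
      using that by blast
    have "(\<Sum>i\<in>I. y i * d i) = 0" if "\<forall>j\<in>X. (\<Sum>i\<in>I. y i * A i j) = 0" for y
      using that col by (intro insert.prems(2)) simp
    from insert.IH[OF insert.prems(1) this]
    obtain z where "\<forall>i\<in>I. (\<Sum>j\<in>X. A i j * z j) = d i"
      by blast
    then show ?thesis
      using insert.hyps col by (intro exI[of _ z]) simp
  next
    case True
    then obtain p where p: "p \<in> I" "A p x \<noteq> 0" by blast
    define r where "r i = A i x / A p x" for i
    define J where "J = I - {p}"
    have J: "finite J" "I = insert p J" "p \<notin> J"
      using insert.prems(1) p(1) by (auto simp: J_def)
    have "(\<Sum>i\<in>J. y i * (d i - r i * d p)) = 0"
      if y: "\<forall>j\<in>X. (\<Sum>i\<in>J. y i * (A i j - r i * A p j)) = 0" for y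
    proof -
      \<comment> \<open>The weight of the pivot equation is chosen so that combining the original equations with
        \<open>y'\<close> is the same as combining the reduced ones with \<open>y\<close>.\<close>
      define y' where "y' = y(p := - (\<Sum>i\<in>J. y i * r i))"
      have lift: "(\<Sum>i\<in>I. y' i * g i) = (\<Sum>i\<in>J. y i * (g i - r i * g p))" for g :: "'i \<Rightarrow> 'k"
      proof -
        have "(\<Sum>i\<in>J. y' i * g i) = (\<Sum>i\<in>J. y i * g i)"
          using J(3) by (intro sum.cong) (auto simp: y'_def)
        then show ?thesis
          using J by (simp add: y'_def sum_distrib_left algebra_simps sum_subtractf)
      qed
      have "(\<Sum>i\<in>I. y' i * A i j) = 0" if "j \<in> insert x X" for j
        using that y p(2) unfolding lift by (auto simp: r_def)
      then show ?thesis
        using insert.prems(2)[of y'] unfolding lift by blast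
    qed
    from insert.IH[of J "\<lambda>i j. A i j - r i * A p j" "\<lambda>i. d i - r i * d p", OF J(1) this]
    obtain z where z: "\<And>i. i \<in> J \<Longrightarrow> (\<Sum>j\<in>X. (A i j - r i * A p j) * z j) = d i - r i * d p"
      by blast
    define S where "S i = (\<Sum>j\<in>X. A i j * z j)" for i
    have S: "S i - r i * S p = d i - r i * d p" if "i \<in> J" for i
      using z[OF that] by (simp add: S_def sum_subtractf sum_distrib_left algebra_simps)
    define z' where "z' = z(x := (d p - S p) / A p x)"
    have val: "(\<Sum>j\<in>insert x X. A i j * z' j) = r i * (d p - S p) + S i" for i
    proof -
      have "(\<Sum>j\<in>X. A i j * z' j) = S i"
        unfolding S_def using insert.hyps(2) by (intro sum.cong) (auto simp: z'_def)
      then show ?thesis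
        using insert.hyps by (simp add: z'_def r_def)
    qed
    have "(\<Sum>j\<in>insert x X. A i j * z' j) = d i" if "i \<in> I" for i
    proof (cases "i = p")
      case True
      then show ?thesis unfolding val using p(2) by (simp add: r_def)
    next
      case False
      then have "i \<in> J" using that J(2) by blast
      from S[OF this] show ?thesis unfolding val by (simp add: algebra_simps)
    qed
    then show ?thesis by blast
  qed
qed

section \<open>Orthogonality of three-bit vectors\<close>

definition dot :: "bits3 \<Rightarrow> bits3 \<Rightarrow> bit" (infixl "\<odot>" 70) where
  "x \<odot> y = (\<Sum>k\<in>UNIV. x $ k * y $ k)"

lemma dot_add_left: "(x + y) \<odot> z = x \<odot> z + y \<odot> z"
  by (simp only: dot_def vector_add_component distrib_right sum.distrib)

lemma dot_add_right: "x \<odot> (y + z) = x \<odot> y + x \<odot> z"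
  by (simp only: dot_def vector_add_component distrib_left sum.distrib)

lemma dot_zero [simp]: "0 \<odot> x = 0" "x \<odot> 0 = 0"
  by (simp_all add: dot_def)

lemma dot_sum_right: "x \<odot> (\<Sum>i\<in>A. g i) = (\<Sum>i\<in>A. x \<odot> g i)"
  by (induction A rule: infinite_finite_induct) 
    (simp_all only: not_False_eq_True sum.infinite sum.empty sum.insert dot_zero dot_add_right)

lemma bit_add_self: "(x :: bit) + x = 0"
  by (cases x) simp_all

lemma bits3_add_eq_0_iff: "x + y = 0 \<longleftrightarrow> x = y" for x y :: bits3
  by (metis add.assoc add_0_right add_0 bits3_add_self)

text \<open>
  This is where the dimension enters: two distinct nonzero vectors over the two-element field are
  linearly independent, so in dimension three their orthogonal complement is a line, with a single
  nonzero element. The vectors have so few bits that a case analysis settles it.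
\<close>

lemma plane_normal_unique:
  assumes "p \<noteq> 0" "q \<noteq> 0" "p \<noteq> q"
    and "u \<noteq> 0" "u \<odot> p = 0" "u \<odot> q = 0" and "v \<noteq> 0" "v \<odot> p = 0" "v \<odot> q = 0"
  shows "u = v"
  using assms unfolding dot_def sum_3 vec_eq_iff forall_3
  by (cases "p $ 1"; cases "p $ 2"; cases "p $ 3"; simp;
      cases "q $ 1"; cases "q $ 2"; cases "q $ 3"; simp;
      cases "u $ 1"; cases "u $ 2"; cases "u $ 3"; simp;
      cases "v $ 1"; cases "v $ 2"; cases "v $ 3"; simp)

text \<open>
  Here \<open>p\<close>, \<open>q\<close>, \<open>p + q\<close> are the flow values at a vertex and \<open>x\<close>, \<open>y\<close>, \<open>x + y\<close> those of an
  annihilator. The assumptions force \<open>x \<odot> q = y \<odot> p\<close>. If this bit is zero, then \<open>x\<close> and \<open>y\<close> are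
  normal to the plane of \<open>p\<close> and \<open>q\<close>, so \<open>x\<close>, \<open>y\<close> and \<open>x + y\<close> are zero or the unique normal vector
  and none or two of them are nonzero. If it is one, it witnesses that all three are nonzero.
\<close>

lemma orthogonal_triples_parity:
  assumes nz: "p \<noteq> 0" "q \<noteq> 0" "p + q \<noteq> 0"
    and orth: "x \<odot> p = 0" "y \<odot> q = 0" "(x + y) \<odot> (p + q) = 0"
  shows "y \<odot> p = of_bool (x \<noteq> 0) + of_bool (y \<noteq> 0) + of_bool (x + y \<noteq> 0)"
proof -
  have "y \<odot> p + x \<odot> q = 0"
    using orth(3) by (simp only: dot_add_left dot_add_right orth(1,2) add_0 add_0_right)
  then have sym: "x \<odot> q = y \<odot> p"
    by (metis add.assoc add_0_right add_0 bit_add_self)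
  show ?thesis
  proof (cases "y \<odot> p = 0")
    case True
    then have "x = y" if "x \<noteq> 0" "y \<noteq> 0"
      using that nz orth(1,2) sym by (intro plane_normal_unique[of p q]) (simp_all add: bits3_add_eq_0_iff)
    with True show ?thesis
      by (cases "x = 0"; cases "y = 0") (auto simp: bits3_add_self)
  next
    case False
    then have 1: "y \<odot> p = 1" by simp
    have "x \<noteq> 0" "y \<noteq> 0"
      using 1 sym by auto
    moreover have "(x + y) \<odot> p = 1"
      using 1 by (simp only: dot_add_left orth(1) add_0)
    then have "x + y \<noteq> 0"
      by auto
    ultimately show ?thesis
      using 1 by simp
  qed
qed

section \<open>Solvability of the triangle-gluing system\<close>

lemma sum_over_incidences:
  assumes "finite_multigraph G"
  shows "(\<Sum>v\<in>verts G. \<Sum>e\<in>incident G v. h v e) = (\<Sum>e\<in>edges G. \<Sum>v\<in>set_uprod (ends G e). h v e)"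
proof -
  have "(\<Sum>v\<in>verts G. \<Sum>e\<in>incident G v. h v e) =
      (\<Sum>e\<in>edges G. \<Sum>v | v \<in> verts G \<and> v \<in> set_uprod (ends G e). h v e)"
    using assms unfolding incident_def finite_multigraph_def by (intro sum.swap_restrict) auto
  also have "\<dots> = (\<Sum>e\<in>edges G. \<Sum>v\<in>set_uprod (ends G e). h v e)"
    using assms by (intro sum.cong refl) (auto simp: finite_multigraph_def)
  finally show ?thesis .
qed

lemma sum_ends:
  assumes "loopless G" "e \<in> edges G" "ends G e = Upair u v"
  shows "(\<Sum>w\<in>set_uprod (ends G e). g w) = g u + g v"
  using assms by (force simp: loopless_def)

text \<open>
  Without loops, every edge at \<open>v\<close> has \<open>v\<close> as exactly one of head and tail, and in characteristic
  two the balance of inflow and outflow is the vanishing of their sum.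
\<close>

lemma three_bit_flow_sum_incident:
  assumes G: "finite_multigraph G" "loopless G" and f: "three_bit_flow G f" and v: "v \<in> verts G"
  shows "(\<Sum>e\<in>incident G v. f e) = 0"
proof -
  obtain tail head where o: "orientation G tail head"
    and bal: "(\<Sum>e | e \<in> edges G \<and> tail e = v. f e) = (\<Sum>e | e \<in> edges G \<and> head e = v. f e)"
    using f v unfolding three_bit_flow_def by blast
  have ends: "ends G e = Upair (tail e) (head e)" "tail e \<noteq> head e" if "e \<in> edges G" for e
    using o G(2) that unfolding orientation_def loopless_def by force+
  have "incident G v = {e. e \<in> edges G \<and> tail e = v} \<union> {e. e \<in> edges G \<and> head e = v}"
    by (auto simp: incident_def ends)
  moreover have "{e. e \<in> edges G \<and> tail e = v} \<inter> {e. e \<in> edges G \<and> head e = v} = {}"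
    using ends(2) by fastforce
  ultimately have "(\<Sum>e\<in>incident G v. f e) =
      (\<Sum>e | e \<in> edges G \<and> tail e = v. f e) + (\<Sum>e | e \<in> edges G \<and> head e = v. f e)"
    using G(1) by (simp add: finite_multigraph_def sum.union_disjoint)
  then show ?thesis
    by (simp only: bal bits3_add_self)
qed

lemma incidence_orderingD:
  assumes "incidence_ordering G a b c" "v \<in> verts G"
  shows "incident G v = {a v, b v, c v}" "a v \<noteq> b v" "a v \<noteq> c v" "b v \<noteq> c v"
    "(\<Sum>e\<in>incident G v. h e) = h (a v) + h (b v) + h (c v)"
  using assms by (auto simp: incidence_ordering_def add.assoc)

lemma ordered_sum_zero:
  fixes h :: "'e \<Rightarrow> bits3"
  assumes "incidence_ordering G a b c" "v \<in> verts G" "(\<Sum>e\<in>incident G v. h e) = 0"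
  shows "h (c v) = h (a v) + h (b v)"
  using assms(3) incidence_orderingD(5)[OF assms(1,2), of h] by (metis bits3_add_eq_0_iff)

text \<open>
  The only corner value that can be nonzero at \<open>v\<close> belongs to \<open>b v\<close>, so the vertex \<open>v\<close> contributes
  \<open>y (b v) \<odot> f (a v)\<close>, which is the parity of the number of edges at \<open>v\<close> in the support of \<open>y\<close>.
  Summed over the vertices, every edge of the support is counted twice.
\<close>

lemma annihilator_orthogonal:
  assumes G: "finite_multigraph G" "loopless G" and f: "three_bit_flow G f" "nowhere_zero G f"
    and ord: "incidence_ordering G a b c"
    and y: "\<And>v. v \<in> verts G \<Longrightarrow> (\<Sum>e\<in>incident G v. y e) = 0"
    and orth: "\<And>e. e \<in> edges G \<Longrightarrow> y e \<odot> f e = 0"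
  shows "(\<Sum>e\<in>edges G. \<Sum>v\<in>set_uprod (ends G e). y e \<odot> corner f a b v e) = 0"
proof -
  have local: "(\<Sum>e\<in>incident G v. y e \<odot> corner f a b v e) = (\<Sum>e\<in>incident G v. of_bool (y e \<noteq> 0))"
    if v: "v \<in> verts G" for v
  proof -
    note inc = incidence_orderingD[OF ord v]
    have mem: "a v \<in> edges G" "b v \<in> edges G" "c v \<in> edges G"
      using inc(1) by (auto simp: incident_def)
    have fc: "f (c v) = f (a v) + f (b v)"
      using three_bit_flow_sum_incident[OF G f(1) v] by (rule ordered_sum_zero[OF ord v])
    have yc: "y (c v) = y (a v) + y (b v)"
      using y[OF v] by (rule ordered_sum_zero[OF ord v])
    have "(\<Sum>e\<in>incident G v. y e \<odot> corner f a b v e) = y (b v) \<odot> f (a v)"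
      unfolding inc(5) using inc(2,4) by (auto simp: corner_def)
    also have "\<dots> = of_bool (y (a v) \<noteq> 0) + of_bool (y (b v) \<noteq> 0) + of_bool (y (c v) \<noteq> 0)"
      unfolding yc
    proof (rule orthogonal_triples_parity)
      show "f (a v) \<noteq> 0" "f (b v) \<noteq> 0" "f (a v) + f (b v) \<noteq> 0"
        using f(2) mem by (auto simp: nowhere_zero_def simp flip: fc)
      show "y (a v) \<odot> f (a v) = 0" "y (b v) \<odot> f (b v) = 0"
        using orth mem by auto
      show "(y (a v) + y (b v)) \<odot> (f (a v) + f (b v)) = 0"
        using orth[OF mem(3)] by (simp only: fc yc)
    qed
    also have "\<dots> = (\<Sum>e\<in>incident G v. of_bool (y e \<noteq> 0))"
      unfolding inc(5) ..
    finally show ?thesis .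
  qed
  have "(\<Sum>e\<in>edges G. \<Sum>v\<in>set_uprod (ends G e). y e \<odot> corner f a b v e) =
      (\<Sum>v\<in>verts G. \<Sum>e\<in>incident G v. y e \<odot> corner f a b v e)"
    using sum_over_incidences[OF G(1)] by (rule sym)
  also have "\<dots> = (\<Sum>v\<in>verts G. \<Sum>e\<in>incident G v. of_bool (y e \<noteq> 0))"
    using local by (rule sum.cong[OF refl])
  also have "\<dots> = (\<Sum>e\<in>edges G. \<Sum>v\<in>set_uprod (ends G e). of_bool (y e \<noteq> 0))"
    by (rule sum_over_incidences[OF G(1)])
  also have "\<dots> = 0"
  proof (rule sum.neutral, rule ballI)
    fix e assume e: "e \<in> edges G"
    obtain u v where uv: "ends G e = Upair u v" by (cases "ends G e")
    show "(\<Sum>v\<in>set_uprod (ends G e). of_bool (y e \<noteq> 0) :: bit) = 0"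
      by (simp only: sum_ends[OF G(2) e uv] bit_add_self)
  qed
  finally show ?thesis .
qed

text \<open>
  The linear system is written in coordinates: one equation for each edge and each bit, and as
  unknowns the bits of the \<open>t v\<close> and the scalars \<open>\<epsilon> e\<close>. The column of the \<open>k\<close>-th bit of \<open>t v\<close> says
  that the \<open>k\<close>-th bits of an annihilator sum to zero at \<open>v\<close>, and the column of \<open>\<epsilon> e\<close> says that its
  value at \<open>e\<close> is orthogonal to \<open>f e\<close>.
\<close>

lemma gluing_solution_exists:
  fixes G :: "('v, 'e) multigraph"
  assumes G: "finite_multigraph G" "loopless G" and f: "three_bit_flow G f" "nowhere_zero G f"
    and ord: "incidence_ordering G a b c"
  shows "\<exists>t \<epsilon>. gluing_solution G f a b t \<epsilon>"
proof -
  let ?I = "edges G \<times> (UNIV :: 3 set)"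
  let ?X = "(verts G \<times> (UNIV :: 3 set)) <+> edges G"
  define A :: "'e \<times> 3 \<Rightarrow> ('v \<times> 3) + 'e \<Rightarrow> bit" where
    "A i x = (case x of Inl (w, j) \<Rightarrow> of_bool (w \<in> set_uprod (ends G (fst i))) * of_bool (j = snd i)
      | Inr e \<Rightarrow> of_bool (e = fst i) * f (fst i) $ snd i)" for i x
  define d where "d e = (\<Sum>w\<in>set_uprod (ends G e). corner f a b w e)" for e
  have fin: "finite (verts G)" "finite (edges G)"
    using G(1) by (simp_all add: finite_multigraph_def)
  have "\<exists>z. \<forall>i\<in>?I. (\<Sum>x\<in>?X. A i x * z x) = d (fst i) $ snd i"
  proof (rule linear_system_solvable)
    show "finite ?X" "finite ?I"
      using fin by auto
    fix y0 :: "'e \<times> 3 \<Rightarrow> bit"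
    assume ann: "\<forall>x\<in>?X. (\<Sum>i\<in>?I. y0 i * A i x) = 0"
    define y :: "'e \<Rightarrow> bits3" where "y e = (\<chi> k. y0 (e, k))" for e
    have flow: "(\<Sum>e\<in>incident G v. y e) = 0" if v: "v \<in> verts G" for v
    proof -
      have "(\<Sum>e\<in>incident G v. y e) $ k = 0" for k
      proof -
        have "0 = (\<Sum>i\<in>?I. y0 i * A i (Inl (v, k)))"
          by (rule sym, rule bspec[OF ann]) (use v in auto)
        also have "\<dots> = (\<Sum>e\<in>edges G. \<Sum>j\<in>UNIV. y0 (e, j) * A (e, j) (Inl (v, k)))"
          by (simp only: sum.cartesian_product split_def prod.collapse)
        also have "\<dots> = (\<Sum>e\<in>edges G. if v \<in> set_uprod (ends G e) then y e $ k else 0)"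
        proof (rule sum.cong[OF refl])
          fix e
          have "(\<Sum>j\<in>UNIV. y0 (e, j) * A (e, j) (Inl (v, k))) =
            (\<Sum>j\<in>UNIV. if k = j then (if v \<in> set_uprod (ends G e) then y0 (e, j) else 0) else 0)"
            by (rule sum.cong[OF refl]) (auto simp: A_def)
          then show "(\<Sum>j\<in>UNIV. y0 (e, j) * A (e, j) (Inl (v, k))) =
            (if v \<in> set_uprod (ends G e) then y e $ k else 0)"
            by (simp only: sum.delta' finite UNIV_I if_True y_def vec_lambda_beta)
        qed
        also have "\<dots> = (\<Sum>e\<in>incident G v. y e) $ k"
          unfolding incident_def sum_component using fin(2) by (rule sum.inter_filter[symmetric])
        finally show ?thesis by simp
      qed
      then show ?thesis by (simp add: vec_eq_iff)
    qed
    have orth: "y e \<odot> f e = 0" if e: "e \<in> edges G" for e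
    proof -
      have "0 = (\<Sum>i\<in>?I. y0 i * A i (Inr e))"
        by (rule sym, rule bspec[OF ann]) (use e in auto)
      also have "\<dots> = (\<Sum>e'\<in>edges G. \<Sum>j\<in>UNIV. y0 (e', j) * A (e', j) (Inr e))"
        by (simp only: sum.cartesian_product split_def prod.collapse)
      also have "\<dots> = (\<Sum>e'\<in>edges G. if e = e' then y e' \<odot> f e' else 0)"
      proof (rule sum.cong[OF refl])
        fix e'
        show "(\<Sum>j\<in>UNIV. y0 (e', j) * A (e', j) (Inr e)) = (if e = e' then y e' \<odot> f e' else 0)"
          by (cases "e = e'") (simp_all only: A_def dot_def y_def vec_lambda_beta sum.case fst_conv
              snd_conv of_bool_eq if_True if_False mult_1_left mult_zero_left mult_zero_right sum.neutral_const
              simp_thms)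
      qed
      also have "\<dots> = y e \<odot> f e"
        using e fin(2) by (simp only: sum.delta' if_True)
      finally show ?thesis by simp
    qed
    have "(\<Sum>i\<in>?I. y0 i * d (fst i) $ snd i) = (\<Sum>e\<in>edges G. \<Sum>j\<in>UNIV. y0 (e, j) * d e $ j)"
      by (simp only: sum.cartesian_product split_def prod.collapse)
    also have "\<dots> = (\<Sum>e\<in>edges G. y e \<odot> d e)"
      by (simp only: dot_def y_def vec_lambda_beta)
    also have "\<dots> = (\<Sum>e\<in>edges G. \<Sum>v\<in>set_uprod (ends G e). y e \<odot> corner f a b v e)"
      by (simp only: d_def dot_sum_right)
    also have "\<dots> = 0"
      by (rule annihilator_orthogonal[OF G f ord flow orth])
    finally show "(\<Sum>i\<in>?I. y0 i * d (fst i) $ snd i) = 0" .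
  qed
  then obtain z where z: "\<And>e k. e \<in> edges G \<Longrightarrow> (\<Sum>x\<in>?X. A (e, k) x * z x) = d e $ k"
    by force
  define t :: "'v \<Rightarrow> bits3" where "t v = (\<chi> k. z (Inl (v, k)))" for v
  define \<epsilon> where "\<epsilon> e = z (Inr e)" for e
  have eq: "(\<Sum>w\<in>set_uprod (ends G e). t w) + \<epsilon> e *s f e = d e" if e: "e \<in> edges G" for e
  proof -
    have sub: "set_uprod (ends G e) \<subseteq> verts G"
      using G(1) e by (simp add: finite_multigraph_def)
    have "((\<Sum>w\<in>set_uprod (ends G e). t w) + \<epsilon> e *s f e) $ k = d e $ k" for k
    proof -
      have "d e $ k = (\<Sum>x\<in>?X. A (e, k) x * z x)"
        using z[OF e] by (rule sym)
      also have "\<dots> = (\<Sum>w\<in>verts G. \<Sum>j\<in>UNIV. A (e, k) (Inl (w, j)) * z (Inl (w, j))) +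
          (\<Sum>e'\<in>edges G. A (e, k) (Inr e') * z (Inr e'))"
        using fin by (simp only: sum.Plus finite_cartesian_product finite sum.cartesian_product split_def prod.collapse comp_def)
      also have "(\<Sum>w\<in>verts G. \<Sum>j\<in>UNIV. A (e, k) (Inl (w, j)) * z (Inl (w, j))) =
          (\<Sum>w\<in>verts G. if w \<in> set_uprod (ends G e) then t w $ k else 0)"
      proof (rule sum.cong[OF refl])
        fix w
        have "(\<Sum>j\<in>UNIV. A (e, k) (Inl (w, j)) * z (Inl (w, j))) =
          (\<Sum>j\<in>UNIV. if k = j then (if w \<in> set_uprod (ends G e) then z (Inl (w, j)) else 0) else 0)"
          by (rule sum.cong[OF refl]) (auto simp: A_def)
        then show "(\<Sum>j\<in>UNIV. A (e, k) (Inl (w, j)) * z (Inl (w, j))) =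
          (if w \<in> set_uprod (ends G e) then t w $ k else 0)"
          by (simp only: sum.delta' finite UNIV_I if_True t_def vec_lambda_beta)
      qed
      also have "\<dots> = (\<Sum>w\<in>set_uprod (ends G e). t w) $ k"
        using sub fin(1) by (simp add: sum_component sum.inter_restrict[symmetric] Int_absorb1)
      also have "(\<Sum>e'\<in>edges G. A (e, k) (Inr e') * z (Inr e')) =
          (\<Sum>e'\<in>edges G. if e = e' then f e' $ k * \<epsilon> e' else 0)"
        by (rule sum.cong[OF refl]) (simp add: A_def \<epsilon>_def)
      also have "\<dots> = (\<epsilon> e *s f e) $ k"
        using e fin(2) by (simp only: sum.delta' if_True vector_smult_component mult.commute)
      finally show ?thesis by (simp only: vector_add_component)
    qed
    then show ?thesis unfolding vec_eq_iff by blast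
  qed
  have "gluing_solution G f a b t \<epsilon>"
    unfolding gluing_solution_def
  proof (intro ballI allI impI)
    fix e u v assume e: "e \<in> edges G" and uv: "ends G e = Upair u v"
    show "t u + t v + \<epsilon> e *s f e = corner f a b u e + corner f a b v e"
      using eq[OF e] by (simp only: d_def sum_ends[OF G(2) e uv])
  qed
  then show ?thesis by blast
qed

section \<open>Connected components\<close>

text \<open>
  For a vertex \<open>u\<close> of \<open>H\<close> this is the connected component of \<open>H\<close> that contains \<open>u\<close>
  (\<open>component_eq_reachable_part\<close> and \<open>reachable_part_component\<close>). It turns the maximality that
  defines components into reachability.
\<close>

definition reachable_part :: "('v, 'e) multigraph \<Rightarrow> 'v \<Rightarrow> ('v, 'e) multigraph" where
  "reachable_part H u = (let V = {w. (u, w) \<in> (adjacency H)\<^sup>*} in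
     \<lparr>verts = V, edges = {e \<in> edges H. set_uprod (ends H e) \<subseteq> V}, ends = ends H\<rparr>)"

lemma reachable_part_simps [simp]:
  "verts (reachable_part H u) = {w. (u, w) \<in> (adjacency H)\<^sup>*}"
  "edges (reachable_part H u) = {e \<in> edges H. set_uprod (ends H e) \<subseteq> {w. (u, w) \<in> (adjacency H)\<^sup>*}}"
  "ends (reachable_part H u) = ends H"
  by (simp_all add: reachable_part_def Let_def)

lemma sym_adjacency: "sym (adjacency H)"
proof (rule symI)
  fix u v assume "(u, v) \<in> adjacency H"
  then obtain e where e: "e \<in> edges H" "ends H e = Upair u v"
    unfolding adjacency_def by blast
  then have "ends H e = Upair v u" by simp
  with e(1) show "(v, u) \<in> adjacency H"
    unfolding adjacency_def by blast
qed

lemma adjacency_mono: "subgraph L H \<Longrightarrow> adjacency L \<subseteq> adjacency H"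
  unfolding subgraph_def adjacency_def by auto

lemma edge_end_reachable:
  assumes "e \<in> edges H" "v \<in> set_uprod (ends H e)" "(u, v) \<in> (adjacency H)\<^sup>*"
  shows "e \<in> edges (reachable_part H u)"
proof -
  obtain w where w: "ends H e = Upair v w"
    using assms(2) by (cases "ends H e") auto
  then have "(v, w) \<in> adjacency H"
    using assms(1) by (auto simp: adjacency_def)
  with assms(3) have "(u, w) \<in> (adjacency H)\<^sup>*"
    by (rule rtrancl_into_rtrancl)
  with assms w show ?thesis by simp
qed

lemma reachable_in_part:
  assumes "(u, w) \<in> (adjacency H)\<^sup>*"
  shows "(u, w) \<in> (adjacency (reachable_part H u))\<^sup>*"
  using assms
proof (induction rule: rtrancl_induct)
  case base
  show ?case by simp
next
  case (step x y)
  then obtain e where e: "e \<in> edges H" "ends H e = Upair x y"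
    by (auto simp: adjacency_def)
  then have "e \<in> edges (reachable_part H u)"
    using step.hyps(1) by (intro edge_end_reachable) auto
  then have "(x, y) \<in> adjacency (reachable_part H u)"
    using e(2) unfolding adjacency_def by (auto simp del: reachable_part_simps(2))
  with step.IH show ?case by (rule rtrancl_into_rtrancl)
qed

lemma reachable_part_subgraph:
  assumes H: "finite_multigraph H" and u: "u \<in> verts H"
  shows "subgraph (reachable_part H u) H"
proof -
  have "w \<in> verts H" if "(u, w) \<in> (adjacency H)\<^sup>*" for w
    using that
  proof (induction rule: rtrancl_induct)
    case (step x y)
    then obtain e where "e \<in> edges H" "ends H e = Upair x y"
      by (auto simp: adjacency_def)
    then show ?case
      using H unfolding finite_multigraph_def by (metis insertCI set_uprod_simps subsetD)
  qed (rule u)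
  then have sub: "{w. (u, w) \<in> (adjacency H)\<^sup>*} \<subseteq> verts H" by blast
  moreover have "finite {w. (u, w) \<in> (adjacency H)\<^sup>*}"
    using H finite_subset[OF sub] by (simp add: finite_multigraph_def)
  ultimately show ?thesis
    using H by (auto simp: subgraph_def finite_multigraph_def)
qed

lemma reachable_part_connected: "connected_graph (reachable_part H u)"
proof -
  let ?A = "adjacency (reachable_part H u)"
  have "(v, w) \<in> ?A\<^sup>*" if "(u, v) \<in> (adjacency H)\<^sup>*" "(u, w) \<in> (adjacency H)\<^sup>*" for v w
  proof -
    have "(v, u) \<in> ?A\<^sup>*"
      using reachable_in_part[OF that(1)] sym_rtrancl[OF sym_adjacency] by (meson symD)
    then show ?thesis
      using reachable_in_part[OF that(2)] by (rule rtrancl_trans)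
  qed
  then show ?thesis
    by (auto simp: connected_graph_def)
qed

lemma connected_subgraph_in_reachable_part:
  assumes L: "subgraph L H" "connected_graph L" and u: "u \<in> verts L"
  shows "subgraph L (reachable_part H u)"
proof -
  have V: "verts L \<subseteq> {w. (u, w) \<in> (adjacency H)\<^sup>*}"
  proof
    fix w assume "w \<in> verts L"
    then have "(u, w) \<in> (adjacency L)\<^sup>*"
      using L(2) u unfolding connected_graph_def by blast
    then have "(u, w) \<in> (adjacency H)\<^sup>*"
      by (rule subsetD[OF rtrancl_mono[OF adjacency_mono[OF L(1)]]])
    then show "w \<in> {w. (u, w) \<in> (adjacency H)\<^sup>*}" by simp
  qed
  have "edges L \<subseteq> edges (reachable_part H u)"
  proof
    fix e assume e: "e \<in> edges L"
    then have "e \<in> edges H" "set_uprod (ends H e) \<subseteq> verts L"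
      using L(1) unfolding subgraph_def finite_multigraph_def by (blast, metis)
    then show "e \<in> edges (reachable_part H u)"
      using subset_trans[OF _ V] by simp
  qed
  then show ?thesis
    using V L(1) unfolding subgraph_def reachable_part_simps(1,3) by blast
qed

lemma subgraph_antisym:
  assumes "subgraph K L" "subgraph L K"
  shows "K = L"
proof (rule multigraph.equality)
  show "verts K = verts L" "edges K = edges L" "ends K = ends L"
    using assms unfolding subgraph_def by blast+
qed simp

lemma subgraph_trans: "subgraph K L \<Longrightarrow> subgraph L M \<Longrightarrow> subgraph K M"
  unfolding subgraph_def by (metis subset_trans)

lemma component_eq_reachable_part:
  assumes H: "finite_multigraph H" and K: "K \<in> components H" and u: "u \<in> verts K"
  shows "K = reachable_part H u"
proof -
  have K': "subgraph K H" "connected_graph K"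
    using K by (auto simp: components_def)
  have "u \<in> verts H"
    using K'(1) u by (auto simp: subgraph_def)
  then have "subgraph (reachable_part H u) H"
    by (rule reachable_part_subgraph[OF H])
  moreover have "L = K" if "subgraph L H" "connected_graph L" "subgraph K L" for L
    using K that unfolding components_def by simp
  ultimately have "reachable_part H u = K"
    using reachable_part_connected connected_subgraph_in_reachable_part[OF K' u] by metis
  then show ?thesis by (rule sym)
qed

lemma reachable_part_component:
  assumes H: "finite_multigraph H" and u: "u \<in> verts H"
  shows "reachable_part H u \<in> components H"
proof -
  have "L = reachable_part H u"
    if L: "subgraph L H" "connected_graph L" "subgraph (reachable_part H u) L" for L
  proof -
    have "u \<in> verts L"
      using L(3) by (auto simp: subgraph_def)
    then show ?thesis
      using connected_subgraph_in_reachable_part[OF L(1,2)] L(3) subgraph_antisym by blast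
  qed
  then show ?thesis
    using reachable_part_subgraph[OF H u] reachable_part_connected by (auto simp: components_def)
qed

lemma component_containing_edge_unique:
  assumes H: "finite_multigraph H" and e: "e \<in> edges H"
  shows "\<exists>!K. K \<in> components H \<and> e \<in> edges K"
proof -
  obtain u v where uv: "ends H e = Upair u v" by (cases "ends H e")
  have u: "u \<in> set_uprod (ends H e)" by (simp add: uv)
  then have "u \<in> verts H"
    using H e by (auto simp: finite_multigraph_def)
  then have "reachable_part H u \<in> components H"
    by (rule reachable_part_component[OF H])
  moreover have "e \<in> edges (reachable_part H u)"
    using e u by (intro edge_end_reachable) auto
  moreover have "K = reachable_part H u" if K: "K \<in> components H" "e \<in> edges K" for K
  proof -
    have "finite_multigraph K" "ends K = ends H"
      using K(1) by (auto simp: components_def subgraph_def)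
    then have "u \<in> verts K"
      using K(2) u by (auto simp: finite_multigraph_def)
    then show ?thesis
      by (rule component_eq_reachable_part[OF H K(1)])
  qed
  ultimately show ?thesis by blast
qed

lemma incident_component:
  assumes H: "finite_multigraph H" and K: "K \<in> components H" and v: "v \<in> verts K"
  shows "incident K v = incident H v"
proof -
  have K_eq: "K = reachable_part H v"
    by (rule component_eq_reachable_part[OF H K v])
  have "e \<in> edges K" if "e \<in> edges H" "v \<in> set_uprod (ends H e)" for e
    unfolding K_eq using that by (rule edge_end_reachable) (rule rtrancl_refl)
  moreover have "edges K \<subseteq> edges H" "ends K = ends H"
    using K by (auto simp: components_def subgraph_def)
  ultimately show ?thesis
    by (auto simp: incident_def)
qed

lemma incident_nonempty_if_connected:
  assumes K: "finite_multigraph K" "connected_graph K" and e: "e \<in> edges K" and v: "v \<in> verts K"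
  shows "incident K v \<noteq> {}"
proof -
  obtain x y where xy: "ends K e = Upair x y" by (cases "ends K e")
  then have "x \<in> verts K"
    using K(1) e by (auto simp: finite_multigraph_def)
  then have "(v, x) \<in> (adjacency K)\<^sup>*"
    using K(2) v unfolding connected_graph_def by blast
  then show ?thesis
  proof (cases rule: converse_rtranclE)
    case base
    then show ?thesis using e xy by (auto simp: incident_def)
  next
    case (step w)
    then show ?thesis by (auto simp: adjacency_def incident_def)
  qed
qed

text \<open>
  A connected graph with an edge has no isolated vertex, and a component keeps all the edges at its
  vertices, so degree 0 is excluded in a component with an edge.
\<close>

lemma component_is_cycle:
  assumes H: "finite_multigraph H" "loopless H" "subgraph H G"
    and deg: "\<And>v. v \<in> verts H \<Longrightarrow> card (incident H v) \<in> {0, 2}"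
    and K: "K \<in> components H" "edges K \<noteq> {}"
  shows "cycle_of G K"
proof -
  have K': "subgraph K H" "connected_graph K"
    using K(1) by (auto simp: components_def)
  then have fin: "finite_multigraph K"
    by (simp add: subgraph_def)
  have "degree K v = 2" if v: "v \<in> verts K" for v
  proof -
    have "incident K v \<noteq> {}"
      using incident_nonempty_if_connected[OF fin K'(2) _ v] K(2) by blast
    moreover have "finite (incident K v)"
      using fin by (simp add: finite_multigraph_def incident_def)
    moreover have "card (incident K v) \<in> {0, 2}"
      unfolding incident_component[OF H(1) K(1) v] using K'(1) v by (intro deg) (auto simp: subgraph_def)
    ultimately have "card (incident K v) = 2" by auto
    moreover have no_loop: "{e \<in> edges K. ends K e = Upair v v} = {}"
      using H(2) K'(1) by (force simp: loopless_def subgraph_def)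
    ultimately show ?thesis
      unfolding degree_def no_loop by simp
  qed
  then show ?thesis
    using subgraph_trans[OF K'(1) H(3)] K'(2) by (simp add: cycle_of_def regular_def)
qed

section \<open>The double cover by components of the label subgraphs\<close>

lemma label_subgraph_properties:
  assumes "finite_multigraph G" "loopless G"
  shows "finite_multigraph (label_subgraph G f a b t s)" "loopless (label_subgraph G f a b t s)"
    "subgraph (label_subgraph G f a b t s) G"
  using assms by (auto simp: finite_multigraph_def loopless_def subgraph_def label_subgraph_def)

text \<open>
  The label sets of \<open>a v\<close>, \<open>b v\<close> and \<open>c v\<close> are the three sides of the triangle with corners
  \<open>t v\<close>, \<open>t v + f (a v)\<close> and \<open>t v + f (c v)\<close>; the corner value of \<open>b v\<close> shifts its side so that the
  triangle closes. A label is a corner, and then on two sides, or it is on no side.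
\<close>

lemma label_subgraph_degree:
  assumes sol: "gluing_solution G f a b t \<epsilon>"
    and ord: "incidence_ordering G a b c" and v: "v \<in> verts G"
    and nz: "nowhere_zero G f" and fc: "f (c v) = f (a v) + f (b v)"
  shows "card (incident (label_subgraph G f a b t s) v) \<in> {0, 2}"
proof -
  note inc = incidence_orderingD(1-4)[OF ord v]
  have mem: "a v \<in> edges G" "b v \<in> edges G" "c v \<in> edges G"
    using inc(1) by (auto simp: incident_def)
  have P: "edge_labels G f a b t e = {t v + corner f a b v e, t v + corner f a b v e + f e}"
    if "e \<in> incident G v" for e
    using edge_labels_eq[OF sol, of e v] that by (simp add: incident_def)
  define x y z where "x = t v" and "y = t v + f (a v)" and "z = t v + f (c v)"
  have "f (a v) \<noteq> 0" "f (b v) \<noteq> 0" "f (c v) \<noteq> 0"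
    using nz mem by (simp_all add: nowhere_zero_def)
  then have distinct: "x \<noteq> y" "y \<noteq> z" "x \<noteq> z"
    by (auto simp: x_def y_def z_def fc)
  have La: "edge_labels G f a b t (a v) = {x, y}"
    using P[of "a v"] inc by (simp add: corner_def x_def y_def)
  have Lb: "edge_labels G f a b t (b v) = {y, z}"
    using P[of "b v"] inc by (simp add: corner_def y_def z_def fc add.assoc)
  have Lc: "edge_labels G f a b t (c v) = {x, z}"
    using P[of "c v"] inc by (simp add: corner_def x_def z_def)
  have "incident (label_subgraph G f a b t s) v =
      {e \<in> {a v, b v, c v}. s \<in> edge_labels G f a b t e}"
    unfolding inc(1)[symmetric] by (auto simp: incident_def label_subgraph_def)
  also have "\<dots> = {e. e = a v \<and> s \<in> {x, y} \<or> e = b v \<and> s \<in> {y, z} \<or> e = c v \<and> s \<in> {x, z}}"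
    by (auto simp: La Lb Lc)
  also have "\<dots> =
      (if s = x then {a v, c v} else if s = y then {a v, b v} else if s = z then {b v, c v} else {})"
    using distinct by auto
  finally show ?thesis
    using inc(2-4) by (simp split: if_splits)
qed

text \<open>
  For each label \<open>s\<close> of \<open>e\<close>, exactly one component of the label subgraph of \<open>s\<close> contains \<open>e\<close>. So
  projecting the pairs \<open>(s, K)\<close> with \<open>e\<close> in \<open>K\<close> to \<open>s\<close> is a bijection onto the two labels of \<open>e\<close>.
\<close>

lemma size_label_components_containing:
  assumes G: "finite_multigraph G" "loopless G" and sol: "gluing_solution G f a b t \<epsilon>"
    and nz: "nowhere_zero G f" and e: "e \<in> edges G"
  shows "size {#C \<in># label_components G f a b t. e \<in> edges C#} = 2"
proof -
  let ?H = "label_subgraph G f a b t"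
  let ?P = "edge_labels G f a b t e"
  obtain u v where uv: "ends G e = Upair u v" by (cases "ends G e")
  then have "?P = {t u + corner f a b u e, t u + corner f a b u e + f e}"
    by (intro edge_labels_eq[OF sol e]) simp
  then have P: "card ?P = 2"
    using nz e by (simp add: nowhere_zero_def)
  have "size {#C \<in># label_components G f a b t. e \<in> edges C#} =
      card {p \<in> label_pairs G f a b t. e \<in> edges (snd p)}"
    using finite_label_pairs[OF G(1)]
    by (simp add: label_components_def filter_mset_image_mset)
  also have "\<dots> = card ?P"
  proof (rule bij_betw_same_card[of fst], rule bij_betwI')
    fix p q
    assume p: "p \<in> {p \<in> label_pairs G f a b t. e \<in> edges (snd p)}"
      and q: "q \<in> {p \<in> label_pairs G f a b t. e \<in> edges (snd p)}"
    have "e \<in> edges (?H (fst p))"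
      using p by (auto simp: label_pairs_def components_def subgraph_def)
    from component_containing_edge_unique[OF label_subgraph_properties(1)[OF G] this]
    show "fst p = fst q \<longleftrightarrow> p = q"
      using p q by (auto simp: label_pairs_def)
  next
    fix p assume "p \<in> {p \<in> label_pairs G f a b t. e \<in> edges (snd p)}"
    then show "fst p \<in> ?P"
      by (auto simp: label_pairs_def components_def subgraph_def label_subgraph_def)
  next
    fix s assume "s \<in> ?P"
    then have "e \<in> edges (?H s)"
      using e by (simp add: label_subgraph_def)
    from component_containing_edge_unique[OF label_subgraph_properties(1)[OF G] this]
    show "\<exists>p\<in>{p \<in> label_pairs G f a b t. e \<in> edges (snd p)}. s = fst p"
      by (force simp: label_pairs_def)
  qed
  finally show ?thesis using P by simp
qed

lemma label_components_cycle_double_cover: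
  assumes G: "finite_multigraph G" "loopless G" and f: "three_bit_flow G f" "nowhere_zero G f"
    and ord: "incidence_ordering G a b c" and sol: "gluing_solution G f a b t \<epsilon>"
  shows "cycle_double_cover G (label_components G f a b t)"
proof -
  have "cycle_of G K" if K: "(s, K) \<in> label_pairs G f a b t" for s K
  proof (rule component_is_cycle)
    let ?H = "label_subgraph G f a b t s"
    show "finite_multigraph ?H" "loopless ?H" "subgraph ?H G"
      by (rule label_subgraph_properties[OF G])+
    show "K \<in> components ?H" "edges K \<noteq> {}"
      using K by (simp_all add: label_pairs_def)
    fix v assume "v \<in> verts ?H"
    then have v: "v \<in> verts G" by (simp add: label_subgraph_def)
    have "f (c v) = f (a v) + f (b v)"
      using three_bit_flow_sum_incident[OF G f(1) v] by (rule ordered_sum_zero[OF ord v])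
    then show "card (incident ?H v) \<in> {0, 2}"
      by (rule label_subgraph_degree[OF sol ord v f(2)])
  qed
  then have "\<forall>C\<in>#label_components G f a b t. cycle_of G C"
    using finite_label_pairs[OF G(1)] by (auto simp: label_components_def)
  then show ?thesis
    unfolding cycle_double_cover_def
    using size_label_components_containing[OF G sol f(2)] by blast
qed

lemma incidence_ordering_exists:
  assumes "loopless G" "cubic G"
  shows "\<exists>a b c. incidence_ordering G a b c"
proof -
  have "\<exists>x y z. distinct [x, y, z] \<and> incident G v = {x, y, z}" if v: "v \<in> verts G" for v
  proof -
    have "{e \<in> edges G. ends G e = Upair v v} = {}"
      using assms(1) by (force simp: loopless_def)
    then have "card (incident G v) = 3"
      using assms(2) v unfolding regular_def degree_def by (metis add_0_right card.empty)
    then show ?thesis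
      by (auto simp: card_3_iff)
  qed
  then show ?thesis
    unfolding incidence_ordering_def by metis
qed

theorem theorem10p2:
  fixes G :: "('v, 'e) multigraph"
  assumes "finite_multigraph G" and "loopless G" and "cubic G"
  shows "((\<exists>f. three_bit_flow G f \<and> nowhere_zero G f) \<longrightarrow> (\<exists>M. cycle_double_cover G M)) \<and>
    (\<forall>f a b c t \<epsilon>.
       three_bit_flow G f \<and> nowhere_zero G f \<and> incidence_ordering G a b c \<and>
       gluing_solution G f a b t \<epsilon> \<longrightarrow>
       cycle_double_cover G (label_components G f a b t))"
proof (intro conjI impI allI; (elim exE conjE)?)
  fix f assume f: "three_bit_flow G f" "nowhere_zero G f"
  obtain a b c where ord: "incidence_ordering G a b c"
    using incidence_ordering_exists[OF assms(2,3)] by blast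
  obtain t \<epsilon> where "gluing_solution G f a b t \<epsilon>"
    using gluing_solution_exists[OF assms(1,2) f ord] by blast
  then show "\<exists>M. cycle_double_cover G M"
    using label_components_cycle_double_cover[OF assms(1,2) f ord] by blast
next
  fix f a b c t \<epsilon>
  assume "three_bit_flow G f" "nowhere_zero G f" "incidence_ordering G a b c"
    "gluing_solution G f a b t \<epsilon>"
  then show "cycle_double_cover G (label_components G f a b t)"
    by (rule label_components_cycle_double_cover[OF assms(1,2)])
qed

end
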